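(* Consider the CODA dynamics. If $A\subseteq\mathcal{V}$ is a robust polarized cluster with $q_i(0)=0$ for a certain $i\in A$, then \begin{itemize} \item for all $i\in A$ and all $k\in\mathbb{N}$, $q_i(k)=0$; \item for all $i\in A$, $\displaystyle\lim_{k\to\infty}p_i(k)\le\frac12$. \end{itemize}
   Context: $\mathcal{V}=\{1,\dots,n\}$ is a finite set of agents and $\mathcal{G}=(\mathcal{V},\mathcal{E})$ is a fixed graph (directed or undirected, without self-loops; no connectivity is assumed). $N_i=\{j\in\mathcal{V}:(j,i)\in\mathcal{E}\}$ is the set of agents influencing $i$, and $n_i=|N_i|$ (possibly $0$). Time is $k\in\mathbb{N}=\{0,1,2,\dots\}$. Each agent has an opinion $p_i(k)$, with initial opinions $p_i(0)\in(0,1)$, $p_i(0)\ne\frac12$, and an action $q_i(k)\in\{0,1\}$ defined by: $q_i(k)=0$ if $p_i(k)<\frac12$; $q_i(k)=0$ if $p_i(k)=\frac12$ and $p_i(k-1)<\frac12$; $q_i(k)=1$ otherwise. The CODA (continuous opinions, discrete actions) dynamics is $$p_i(k+1)=p_i(k)+\frac{p_i(k)(1-p_i(k))}{n_i}\sum_{j\in N_i}(q_j(k)-p_i(k)),\qquad i\in\mathcal{V},\ k\in\mathbb{N},$$ with the convention that $p_i(k+1)=p_i(k)$ if $n_i=0$. A subset $A\subseteq\mathcal{V}$ is a robust polarized cluster if (i) $q_i(0)=q_j(0)$ for all $i,j\in A$, and (ii) $|N_i\cap A|\ge|N_i\setminus A|$ for all $i\in A$, where $|\cdot|$ denotes cardi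nality.
   Formalization: The limit of p_i(k) need not exist (opinions in A can oscillate forever), so the second bullet is stated as limsup of p_i(k) at most 1/2 for all i in A, together with lim p_i(k) at most 1/2 whenever p_i converges. *)

theory Defs
  imports Complex_Main "HOL-Library.Extended_Real"
begin

(* Agents are the natural numbers in {1..n}.  A graph is its edge relation E, and (j, i) \<in> E
   means that agent j influences agent i; an undirected graph is the case of a symmetric E.
   An opinion profile p maps an agent i and a time k to p_i(k). *)

definition graph_on :: "nat \<Rightarrow> (nat \<times> nat) set \<Rightarrow> bool" where
  "graph_on n E \<longleftrightarrow> E \<subseteq> {1..n} \<times> {1..n} \<and> irrefl E"

definition nbrs :: "nat \<Rightarrow> (nat \<times> nat) set \<Rightarrow> nat \<Rightarrow> nat set" where
  "nbrs n E i = {j \<in> {1..n}. (j, i) \<in> E}"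

(* At time 0 there is no previous opinion, so the tie-breaking clause is guarded by k > 0. *)
definition action :: "(nat \<Rightarrow> nat \<Rightarrow> real) \<Rightarrow> nat \<Rightarrow> nat \<Rightarrow> nat" where
  "action p i k =
     (if p i k < 1/2 then 0
      else if p i k = 1/2 \<and> k > 0 \<and> p i (k - 1) < 1/2 then 0
      else 1)"

definition coda_dynamics :: "nat \<Rightarrow> (nat \<times> nat) set \<Rightarrow> (nat \<Rightarrow> nat \<Rightarrow> real) \<Rightarrow> bool" where
  "coda_dynamics n E p \<longleftrightarrow>
     (\<forall>i\<in>{1..n}. 0 < p i 0 \<and> p i 0 < 1 \<and> p i 0 \<noteq> 1/2) \<and>
     (\<forall>i\<in>{1..n}. \<forall>k.
        p i (Suc k) =
          (if card (nbrs n E i) = 0 then p i k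
           else p i k + p i k * (1 - p i k) / real (card (nbrs n E i)) *
                  (\<Sum>j\<in>nbrs n E i. (real (action p j k) - p i k))))"

definition robust_polarized_cluster ::
  "nat \<Rightarrow> (nat \<times> nat) set \<Rightarrow> (nat \<Rightarrow> nat \<Rightarrow> real) \<Rightarrow> nat set \<Rightarrow> bool" where
  "robust_polarized_cluster n E p A \<longleftrightarrow>
     A \<subseteq> {1..n} \<and>
     (\<forall>i\<in>A. \<forall>j\<in>A. action p i 0 = action p j 0) \<and>
     (\<forall>i\<in>A. card (nbrs n E i \<inter> A) \<ge> card (nbrs n E i - A))"

end

theory Submission
  imports Defs
begin

text \<open>As long as all actions in the cluster are 0, the average action seen by an agent of the
  cluster is some \<open>a \<le> 1/2\<close>. Then \<open>1/2 - p\<^sub>i\<close> is multiplied in each step by at least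
  \<open>1 - p\<^sub>i (1 - p\<^sub>i) > 0\<close>, so the opinion stays strictly below 1/2. The tie-breaking rule of the
  action therefore never applies inside the cluster.\<close>

lemma action_le_1: "action p i k \<le> 1"
  by (simp add: action_def)

lemma action_eq_0_if_less: "p i k < 1/2 \<Longrightarrow> action p i k = 0"
  by (simp add: action_def)

text \<open>For \<open>c = x * (1 - x)\<close>, which lies strictly between 0 and 1, the new value
  is the convex combination \<open>(1 - c) * x + c * a\<close>. As \<open>x\<close> has positive
  weight, its strict bounds survive even if \<open>a\<close> is 0 or 1/2.\<close>

lemma coda_step_bounds:
  fixes x a :: real
  assumes "0 < x" "x < 1/2" "0 \<le> a" "a \<le> 1/2"
  shows "0 < x + x * (1 - x) * (a - x)" "x + x * (1 - x) * (a - x) < 1/2"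
proof -
  have pos: "0 < x * (1 - x)"
    using assms by simp
  have less: "x * (1 - x) < 1"
    using mult_strict_mono[of x 1 "1 - x" 1] assms by simp
  have "x * (1 - x) * x < 1 * x"
    using less assms by (intro mult_strict_right_mono) auto
  moreover have "x * (1 - x) * (- x) \<le> x * (1 - x) * (a - x)"
    using pos assms by (intro mult_left_mono) auto
  ultimately show "0 < x + x * (1 - x) * (a - x)"
    by simp
  have "x * (1 - x) * (a - x) \<le> x * (1 - x) * (1/2 - x)"
    using pos assms by (intro mult_left_mono) auto
  also have "\<dots> < 1 * (1/2 - x)"
    using less assms by (intro mult_strict_right_mono) auto
  finally show "x + x * (1 - x) * (a - x) < 1/2"
    by simp
qed

text \<open>Members of \<open>N\<close> inside \<open>A\<close> contribute nothing, those outside at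
  most 1 each, and the latter make up at most half of \<open>N\<close>.\<close>

lemma sum_action_le_half_card:
  assumes "finite N" "card (N - A) \<le> card (N \<inter> A)"
    and "\<And>j. j \<in> N \<inter> A \<Longrightarrow> action p j k = 0"
  shows "(\<Sum>j\<in>N. real (action p j k)) \<le> real (card N) / 2"
proof -
  have "(\<Sum>j\<in>N. real (action p j k)) = (\<Sum>j\<in>N - A. real (action p j k))"
    using assms by (intro sum.mono_neutral_right) auto
  also have "\<dots> \<le> real (card (N - A))"
    using sum_bounded_above[of "N - A" "\<lambda>j. real (action p j k)" 1] action_le_1 by simp
  also have "\<dots> \<le> real (card N) / 2"
    using card_Int_Diff[of N A] assms by simp
  finally show ?thesis .
qed

lemma coda_opinion_bounds_Suc:
  assumes dyn: "coda_dynamics n E p" and clu: "robust_polarized_cluster n E p A"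
    and bounds: "\<And>j. j \<in> A \<Longrightarrow> 0 < p j k \<and> p j k < 1/2" and i: "i \<in> A"
  shows "0 < p i (Suc k) \<and> p i (Suc k) < 1/2"
proof -
  define N where "N = nbrs n E i"
  define a where "a = (\<Sum>j\<in>N. real (action p j k)) / card N"
  have fin: "finite N"
    by (simp add: N_def nbrs_def)
  have card: "card (N - A) \<le> card (N \<inter> A)" and "i \<in> {1..n}"
    using clu i by (auto simp: robust_polarized_cluster_def N_def)
  then have step: "p i (Suc k) = (if card N = 0 then p i k
      else p i k + p i k * (1 - p i k) / card N * (\<Sum>j\<in>N. real (action p j k) - p i k))"
    using dyn unfolding coda_dynamics_def N_def by blast
  show ?thesis
  proof (cases "card N = 0")
    case True
    then show ?thesis using step bounds[OF i] by simp
  next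
    case False
    \<comment> \<open>Averaging the summands over the nonempty \<open>N\<close> gives
      \<open>a - p i k\<close>.\<close>
    have "p i (Suc k) = p i k + p i k * (1 - p i k) * (a - p i k)"
      using False by (simp add: step a_def sum_subtractf field_simps)
    moreover have "0 \<le> a"
      by (simp add: a_def sum_nonneg)
    moreover have "a \<le> 1/2"
      using sum_action_le_half_card[OF fin card, of p k] bounds False
      by (simp add: a_def field_simps action_eq_0_if_less)
    ultimately show ?thesis
      using coda_step_bounds[of "p i k" a] bounds[OF i] by simp
  qed
qed

text \<open>The \<open>limsup\<close> exists in \<open>ereal\<close> whether or not opinions
  converge; \<open>lim\<close> is meaningful only under \<open>convergent\<close>.\<close>

theorem proposition7:
  fixes n :: nat
    and E :: "(nat \<times> nat) set"
    and p :: "nat \<Rightarrow> nat \<Rightarrow> real"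
    and A :: "nat set"
  assumes "graph_on n E"
    and "coda_dynamics n E p"
    and "robust_polarized_cluster n E p A"
    and "\<exists>i\<in>A. action p i 0 = 0"
  shows "(\<forall>i\<in>A. \<forall>k. action p i k = 0) \<and>
         (\<forall>i\<in>A. limsup (\<lambda>k. ereal (p i k)) \<le> ereal (1/2) \<and>
                 (convergent (p i) \<longrightarrow> lim (p i) \<le> 1/2))"
proof -
  have bounds: "0 < p i k \<and> p i k < 1/2" if "i \<in> A" for i k
    using that
  \<comment> \<open>The next opinion of \<open>i\<close> depends on its neighbours in
    \<open>A\<close>, so the bounds must hold for all of \<open>A\<close> at once.\<close>
  proof (induction k arbitrary: i)
    case 0
    then have "action p i 0 = 0" "i \<in> {1..n}"
      using assms(3,4) unfolding robust_polarized_cluster_def by (metis, blast)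
    \<comment> \<open>At time 0 the guard \<open>k > 0\<close> blocks the tie-breaking clause, so
      action 0 forces \<open>p i 0 < 1/2\<close>.\<close>
    then show ?case
      using assms(2) by (auto simp: coda_dynamics_def action_def split: if_splits)
  next
    case (Suc k)
    then show ?case
      using coda_opinion_bounds_Suc[OF assms(2,3)] by blast
  qed
  have "limsup (\<lambda>k. ereal (p i k)) \<le> ereal (1/2)" if "i \<in> A" for i
    using bounds[OF that] by (intro Limsup_bounded always_eventually allI) (simp add: less_imp_le)
  moreover have "lim (p i) \<le> 1/2" if "i \<in> A" "convergent (p i)" for i
    using bounds[OF that(1)] by (intro lim_le[OF that(2)]) (simp add: less_imp_le)
  ultimately show ?thesis
    using bounds action_eq_0_if_less by blast
qed

end
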